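(* For all non-negative integers $m,n$, the Lucas analogue of the super FiboCatalan number, $$S\{m,n\}=\frac{\{2m\}!\,\{2n\}!}{\{m\}!\,\{n\}!\,\{m+n\}!},$$ is a polynomial in $s$ and $t$ with non-negative integer coefficients.
   Context: The Lucas polynomials $\{n\}$ in two variables $s,t$ are defined by $\{0\}=0$, $\{1\}=1$, and $\{n\}=s\{n-1\}+t\{n-2\}$ for $n\ge 2$. For $n\ge 1$, $\{n\}!=\{n\}\{n-1\}\cdots\{2\}\{1\}$, and $\{0\}!=1$ (empty product). Quotients are a priori taken in the field of rational functions $\mathbb{Q}(s,t)$. *)

theory Defs
  imports "HOL-Computational_Algebra.Computational_Algebra"
begin

(* The bivariate polynomial ring Q[s,t] is represented as Q[s][t], i.e. rat poly poly:
   coeff (coeff p j) i is the coefficient of s^i t^j in p.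
   Its field of fractions rat poly poly fract is Q(s,t). *)

definition var_s :: "rat poly poly" where
  "var_s = [:[:0, 1:]:]"

definition var_t :: "rat poly poly" where
  "var_t = [:0, 1:]"

fun lucas :: "nat \<Rightarrow> rat poly poly" where
  "lucas 0 = 0"
| "lucas (Suc 0) = 1"
| "lucas (Suc (Suc n)) = var_s * lucas (Suc n) + var_t * lucas n"

definition lucas_fact :: "nat \<Rightarrow> rat poly poly" where
  "lucas_fact n = (\<Prod>k=1..n. lucas k)"

definition super_fibo_catalan :: "nat \<Rightarrow> nat \<Rightarrow> rat poly poly fract" where
  "super_fibo_catalan m n =
     (to_fract (lucas_fact (2 * m)) * to_fract (lucas_fact (2 * n))) /
     (to_fract (lucas_fact m) * to_fract (lucas_fact n) * to_fract (lucas_fact (m + n)))"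

definition nonneg_int_coeffs :: "rat poly poly \<Rightarrow> bool" where
  "nonneg_int_coeffs p \<longleftrightarrow> (\<forall>i j. coeff (coeff p j) i \<in> \<nat>)"

(* The denominator of super_fibo_catalan never vanishes, so the convention x / 0 = 0
   plays no role. *)

lemma poly_lucas_pos: "n > 0 \<Longrightarrow> poly (poly (lucas n) 1) 1 > 0"
proof (induction n rule: lucas.induct)
  case (3 n)
  then show ?case
    by (cases n) (auto simp: var_s_def var_t_def)
qed auto

lemma lucas_fact_nonzero: "lucas_fact n \<noteq> 0"
proof -
  have "lucas k \<noteq> 0" if "k > 0" for k
    using poly_lucas_pos[OF that] by auto
  then show ?thesis
    by (simp add: lucas_fact_def)
qed

lemma monomial_coeff:
  "coeff (coeff (var_s ^ a * var_t ^ b) j) i = (if i = a \<and> j = b then 1 else 0)"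
proof -
  have s: "var_s = monom (monom 1 1) 0" and t: "var_t = monom 1 1"
    by (simp_all add: var_s_def var_t_def monom_altdef)
  have "var_s ^ a * var_t ^ b = monom (monom 1 a) b"
    unfolding s t monom_power mult_monom by simp
  then show ?thesis
    by auto
qed

end

theory Submission
  imports Defs
begin

text \<open>
  With \<open>t = - r\<^sup>2\<close> fixed, the Lucas polynomial \<open>{n}\<close> is monic in \<open>s\<close> with the simple roots
  \<open>2 r cos (\<pi> k / n)\<close>, \<open>0 < k < n\<close>. Pairing the roots for \<open>k\<close> and \<open>n - k\<close> writes \<open>{n}\<close> as a product
  of the real polynomials \<open>s\<^sup>2 + 4 cos\<^sup>2 (\<pi> k / n) t\<close> (and \<open>s\<close> if \<open>n\<close> is even), all with non-negative
  coefficients. Such a factor depends only on the fraction \<open>k / n\<close>, so collecting the reduced fractions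
  of denominator \<open>d\<close> into an atom yields \<open>{n}\<close> as the product of the atoms of the divisors of \<open>n\<close>, and
  \<open>S{m,n}\<close> as a product of atoms with exponents
  \<open>\<lfloor>2m/d\<rfloor> + \<lfloor>2n/d\<rfloor> - \<lfloor>m/d\<rfloor> - \<lfloor>n/d\<rfloor> - \<lfloor>(m+n)/d\<rfloor> \<ge> 0\<close>. Hence its coefficients are non-negative reals.
  They are integers because the denominator is a power of \<open>s\<close> modulo \<open>t\<close>, so that the quotient can be
  computed over \<open>\<int>\<close> by successive comparison of the coefficients of powers of \<open>t\<close>.
\<close>

section \<open>Bivariate polynomials with coefficients in a subset\<close>

text \<open>The set is a parameter because the closure lemmas serve both \<open>\<int>\<close> and
  the non-negative reals.\<close>

definition coeffs2_in :: "'a::zero set \<Rightarrow> 'a poly poly \<Rightarrow> bool" where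
  "coeffs2_in S p \<longleftrightarrow> (\<forall>i j. coeff (coeff p j) i \<in> S)"

lemma sum_in_closed:
  assumes "0 \<in> S" "\<And>x y. x \<in> S \<Longrightarrow> y \<in> S \<Longrightarrow> x + y \<in> S" "\<And>a. a \<in> A \<Longrightarrow> f a \<in> S"
  shows "sum f A \<in> (S :: 'a::comm_monoid_add set)"
  using assms(3) by (induction A rule: infinite_finite_induct) (auto intro: assms(1,2))

lemma coeffs2_in_mult:
  fixes p q :: "'a::comm_semiring_0 poly poly"
  assumes "0 \<in> S" "\<And>x y. x \<in> S \<Longrightarrow> y \<in> S \<Longrightarrow> x + y \<in> S" "\<And>x y. x \<in> S \<Longrightarrow> y \<in> S \<Longrightarrow> x * y \<in> S"
    and "coeffs2_in S p" "coeffs2_in S q"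
  shows "coeffs2_in S (p * q)"
  using assms(4,5) unfolding coeffs2_in_def coeff_mult coeff_sum
  by (intro allI sum_in_closed assms(1-3)) auto

lemma coeffs2_in_one: "0 \<in> S \<Longrightarrow> 1 \<in> S \<Longrightarrow> coeffs2_in S (1 :: 'a::comm_semiring_1 poly poly)"
  by (auto simp: coeffs2_in_def)

lemma coeffs2_in_prod:
  fixes f :: "'b \<Rightarrow> 'a::comm_semiring_1 poly poly"
  assumes "0 \<in> S" "1 \<in> S" "\<And>x y. x \<in> S \<Longrightarrow> y \<in> S \<Longrightarrow> x + y \<in> S"
    "\<And>x y. x \<in> S \<Longrightarrow> y \<in> S \<Longrightarrow> x * y \<in> S" "\<And>a. a \<in> A \<Longrightarrow> coeffs2_in S (f a)"
  shows "coeffs2_in S (prod f A)"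
  using assms(5)
  by (induction A rule: infinite_finite_induct)
     (auto intro!: coeffs2_in_one coeffs2_in_mult assms(1-4))

lemma coeffs2_in_power:
  fixes p :: "'a::comm_semiring_1 poly poly"
  assumes "0 \<in> S" "1 \<in> S" "\<And>x y. x \<in> S \<Longrightarrow> y \<in> S \<Longrightarrow> x + y \<in> S"
    "\<And>x y. x \<in> S \<Longrightarrow> y \<in> S \<Longrightarrow> x * y \<in> S" "coeffs2_in S p"
  shows "coeffs2_in S (p ^ n)"
  using coeffs2_in_prod[of S "{..<n}" "\<lambda>_. p"] assms by simp

text \<open>Comparing coefficients of t^j gives s^k Q_j plus terms with the earlier Q_l, l < j.
  Multiplication by s^k only shifts coefficients, so no division takes place and induction on j
  stays inside \<open>\<int>\<close>.\<close>

lemma coeffs2_in_Ints_divide: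
  fixes B Q :: "'a::idom poly poly"
  assumes "coeffs2_in \<int> (B * Q)" "coeffs2_in \<int> B" and low: "coeff B 0 = monom 1 k"
  shows "coeffs2_in \<int> Q"
proof -
  have "\<forall>i. coeff (coeff Q j) i \<in> \<int>" for j
  proof (induction j rule: less_induct)
    case (less j)
    show ?case
    proof
      fix i
      have "coeff (B * Q) j = (\<Sum>l\<le>j. coeff B l * coeff Q (j - l))"
        by (rule coeff_mult)
      also have "\<dots> = monom 1 k * coeff Q j + (\<Sum>l\<in>{1..j}. coeff B l * coeff Q (j - l))"
        by (simp add: atMost_atLeast0 sum.atLeast_Suc_atMost low)
      finally have "coeff (coeff (B * Q) j) (k + i) =
          coeff (coeff Q j) i + coeff (\<Sum>l\<in>{1..j}. coeff B l * coeff Q (j - l)) (k + i)"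
        by (simp add: coeff_monom_mult)
      moreover have "coeff (\<Sum>l\<in>{1..j}. coeff B l * coeff Q (j - l)) (k + i) \<in> \<int>"
        using assms(2) less unfolding coeff_sum coeff_mult coeffs2_in_def
        by (intro sum_in_closed) auto
      moreover have "coeff (coeff (B * Q) j) (k + i) \<in> \<int>"
        using assms(1) by (auto simp: coeffs2_in_def)
      ultimately show "coeff (coeff Q j) i \<in> \<int>"
        by (metis Ints_diff add_diff_cancel_right')
    qed
  qed
  then show ?thesis by (auto simp: coeffs2_in_def)
qed

text \<open>Otherwise \<open>p - q\<close> would be a nonzero polynomial over an integral domain
  with infinitely many roots, namely the constants from \<open>C\<close>. This allows identities to
  be checked for fixed values of t.\<close>

lemma poly_poly_eqI:
  fixes p q :: "'a::idom poly poly"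
  assumes "infinite C" "\<And>c. c \<in> C \<Longrightarrow> poly p [:c:] = poly q [:c:]"
  shows "p = q"
proof (rule ccontr)
  assume "p \<noteq> q"
  then have "finite {x. poly (p - q) x = 0}"
    by (intro poly_roots_finite) simp
  moreover have "(\<lambda>c. [:c:]) ` C \<subseteq> {x. poly (p - q) x = 0}"
    using assms(2) by auto
  ultimately have "finite ((\<lambda>c. [:c:]) ` C)"
    by (rule rev_finite_subset)
  then show False
    using assms(1) by (auto dest: finite_imageD simp: inj_on_def)
qed


section \<open>Passing to real coefficients\<close>

text \<open>The factors below involve squared cosines, which need not be rational.\<close>

definition real_poly2 :: "rat poly poly \<Rightarrow> real poly poly" where
  "real_poly2 = map_poly (map_poly of_rat)"

lemma coeff_real_poly2: "coeff (coeff (real_poly2 p) j) i = of_rat (coeff (coeff p j) i)"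
  by (simp add: real_poly2_def coeff_map_poly)

lemma poly2_eqI: "(\<And>i j. coeff (coeff p j) i = coeff (coeff q j) i) \<Longrightarrow> p = q"
  by (intro poly_eqI)

lemma real_poly2_eq_iff [simp]: "real_poly2 p = real_poly2 q \<longleftrightarrow> p = q"
proof
  assume "real_poly2 p = real_poly2 q"
  then have "of_rat (coeff (coeff p j) i) = (of_rat (coeff (coeff q j) i) :: real)" for i j
    by (metis coeff_real_poly2)
  then show "p = q"
    by (intro poly2_eqI) simp
qed simp

lemma real_poly2_add [simp]: "real_poly2 (p + q) = real_poly2 p + real_poly2 q"
  by (intro poly2_eqI) (simp add: coeff_real_poly2 of_rat_add)

lemma real_poly2_mult [simp]: "real_poly2 (p * q) = real_poly2 p * real_poly2 q"
  by (intro poly2_eqI)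
     (simp add: coeff_real_poly2 coeff_mult coeff_sum of_rat_sum of_rat_mult)

lemma real_poly2_0 [simp]: "real_poly2 0 = 0"
  by (simp add: real_poly2_def)

lemma real_poly2_1 [simp]: "real_poly2 1 = 1"
  by (simp add: real_poly2_def)

lemma real_poly2_prod [simp]: "real_poly2 (prod f A) = (\<Prod>a\<in>A. real_poly2 (f a))"
  by (induction A rule: infinite_finite_induct) auto

lemma real_poly2_var_s [simp]: "real_poly2 var_s = [:[:0, 1:]:]"
  by (simp add: real_poly2_def var_s_def map_poly_pCons)

lemma real_poly2_var_t [simp]: "real_poly2 var_t = [:0, 1:]"
  by (simp add: real_poly2_def var_t_def map_poly_pCons)

lemma coeffs2_in_Ints_lucas: "coeffs2_in \<int> (lucas n)"
proof (induction n rule: lucas.induct)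
  case (3 n)
  have "coeffs2_in \<int> var_s" "coeffs2_in \<int> var_t"
    by (auto simp: coeffs2_in_def var_s_def var_t_def coeff_pCons split: nat.split)
  then have "coeffs2_in \<int> (var_s * lucas (Suc n))" "coeffs2_in \<int> (var_t * lucas n)"
    using 3 by (auto intro!: coeffs2_in_mult)
  then show ?case by (auto simp: coeffs2_in_def)
qed (auto simp: coeffs2_in_def)

text \<open>Modulo t the recursion is just multiplication by s.\<close>

lemma coeff_lucas_Suc_0: "coeff (lucas (Suc n)) 0 = monom 1 n"
proof (induction n)
  case (Suc n)
  then show ?case
    by (simp add: coeff_mult_0 var_s_def var_t_def monom_Suc)
qed simp

lemma coeff_lucas_fact_0: "\<exists>k. coeff (lucas_fact n) 0 = monom 1 k"
proof (induction n)
  case (Suc n)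
  then obtain k where "coeff (lucas_fact n) 0 = monom 1 k" ..
  moreover have "lucas_fact (Suc n) = lucas_fact n * lucas (Suc n)"
    by (simp add: lucas_fact_def)
  ultimately show ?case
    by (auto simp: coeff_mult_0 coeff_lucas_Suc_0 mult_monom simp del: lucas.simps)
next
  case 0
  show ?case
    by (intro exI[of _ 0]) (simp add: lucas_fact_def)
qed

lemma coeffs2_in_Ints_lucas_fact: "coeffs2_in \<int> (lucas_fact n)"
  unfolding lucas_fact_def by (intro coeffs2_in_prod coeffs2_in_Ints_lucas) auto

lemma coeffs2_in_Ints_real_poly2: "coeffs2_in \<int> p \<Longrightarrow> coeffs2_in \<int> (real_poly2 p)"
proof -
  have "real_of_rat x \<in> \<int>" if "x \<in> \<int>" for x
    using that by cases simp
  then show "coeffs2_in \<int> p \<Longrightarrow> coeffs2_in \<int> (real_poly2 p)"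
    by (simp add: coeffs2_in_def coeff_real_poly2)
qed

lemma real_quotient_imp_nonneg_int_quotient:
  assumes eq: "real_poly2 A = real_poly2 B * Q" and nonneg: "coeffs2_in {0..} Q"
    and int: "coeffs2_in \<int> A" "coeffs2_in \<int> B" and low: "coeff B 0 = monom 1 k"
  shows "\<exists>p. A = B * p \<and> nonneg_int_coeffs p"
proof -
  have "coeff (real_poly2 B) 0 = monom 1 k"
    by (intro poly_eqI) (simp add: coeff_real_poly2 low)
  then have "coeffs2_in \<int> Q"
    using int[THEN coeffs2_in_Ints_real_poly2] eq by (simp add: coeffs2_in_Ints_divide)
  then have Q: "coeff (coeff Q j) i \<in> \<int>" "coeff (coeff Q j) i \<ge> 0" for i j
    using nonneg by (auto simp: coeffs2_in_def)
  \<comment> \<open>The coefficients of \<open>Q\<close> are integers, so the floor does not change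
    them; it only carries them from \<open>real\<close> to \<open>rat\<close>.\<close>
  define p :: "rat poly poly" where "p = map_poly (map_poly (\<lambda>x. of_int \<lfloor>x\<rfloor>)) Q"
  have p: "coeff (coeff p j) i = of_int \<lfloor>coeff (coeff Q j) i\<rfloor>" for i j
    by (simp add: p_def coeff_map_poly)
  have "real_poly2 p = Q"
    using Q(1) by (intro poly2_eqI) (simp add: coeff_real_poly2 p)
  with eq have "real_poly2 A = real_poly2 (B * p)"
    by simp
  then have "A = B * p"
    by (simp only: real_poly2_eq_iff)
  moreover have "nonneg_int_coeffs p"
    unfolding nonneg_int_coeffs_def p using Q(2) by (simp add: Nats_altdef2)
  ultimately show ?thesis by blast
qed


section \<open>Factorization of Lucas polynomials\<close>

text \<open>At t = -r^2 this is the product of s - 2 r cos (pi k / n) and s - 2 r cos (pi (n - k) /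
  n). For 2 k = n both are the same factor s, which is taken once.\<close>

definition lucas_factor :: "nat \<Rightarrow> nat \<Rightarrow> real poly poly" where
  "lucas_factor k n =
     (if 2 * k = n then [:[:0, 1:]:] else [:[:0, 0, 1:], [:4 * (cos (pi * k / n))\<^sup>2:]:])"

lemma lucas_factor_scale: "c > 0 \<Longrightarrow> lucas_factor (c * k) (c * n) = lucas_factor k n"
  by (auto simp: lucas_factor_def mult.left_commute)

lemma coeffs2_in_nonneg_lucas_factor: "coeffs2_in {0..} (lucas_factor k n)"
  by (auto simp: lucas_factor_def coeffs2_in_def coeff_pCons split: nat.split)

text \<open>For n > 0 this is the Chebyshev identity U_{n-1}(cos \<theta>) sin \<theta> = sin (n
  \<theta>), rescaled by r. The induction rests on sin (x + \<theta>) + sin (x - \<theta>) = 2 cos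
  \<theta> sin x.\<close>

lemma lucas_sin:
  "r * sin \<theta> * poly (poly (real_poly2 (lucas n)) [:- r\<^sup>2:]) (2 * r * cos \<theta>) = r ^ n * sin (real n * \<theta>)"
proof (induction n rule: lucas.induct)
  case (3 n)
  let ?e = "\<lambda>n. poly (poly (real_poly2 (lucas n)) [:- r\<^sup>2:]) (2 * r * cos \<theta>)"
  have "r * sin \<theta> * ?e (Suc (Suc n)) =
      2 * r * cos \<theta> * (r * sin \<theta> * ?e (Suc n)) - r\<^sup>2 * (r * sin \<theta> * ?e n)"
    by (simp add: algebra_simps)
  also have "\<dots> = r ^ (n + 2) * (2 * cos \<theta> * sin (real (Suc n) * \<theta>) - sin (real n * \<theta>))"
    by (simp only: 3) (simp add: algebra_simps power2_eq_square)
  also have "2 * cos \<theta> * sin (real (Suc n) * \<theta>) - sin (real n * \<theta>) = sin (real (Suc n) * \<theta> + \<theta>)"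
  proof -
    have "sin (real n * \<theta>) = sin (real (Suc n) * \<theta> - \<theta>)"
      by (simp add: algebra_simps)
    then show ?thesis
      by (simp only: sin_add sin_diff) simp
  qed
  finally show ?case
    by (simp add: algebra_simps)
qed auto

lemma degree_lucas_Suc:
  fixes c :: real
  defines "e \<equiv> \<lambda>n. poly (real_poly2 (lucas n)) [:c:]"
  shows "degree (e (Suc n)) \<le> n \<and> coeff (e (Suc n)) n = 1"
proof (induction n rule: less_induct)
  case (less n)
  consider "n = 0" | "n = 1" | k where "n = Suc (Suc k)"
    by (metis One_nat_def not0_implies_Suc)
  then show ?case
  proof cases
    case 3
    have rec: "e (Suc n) = pCons 0 (e (Suc (Suc k))) + smult c (e (Suc k))"
      by (simp add: 3 e_def)
    have IH: "degree (e (Suc (Suc k))) \<le> Suc k" "coeff (e (Suc (Suc k))) (Suc k) = 1"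
      "degree (e (Suc k)) \<le> k"
      using less[of "Suc k"] less[of k] 3 by auto
    have "degree (pCons 0 (e (Suc (Suc k)))) \<le> n" "degree (smult c (e (Suc k))) \<le> n"
      using IH 3 degree_pCons_le[of 0 "e (Suc (Suc k))"] degree_smult_le[of c "e (Suc k)"] by auto
    then have "degree (e (Suc n)) \<le> n"
      unfolding rec by (rule degree_add_le)
    moreover have "coeff (e (Suc n)) n = 1"
      unfolding rec using IH 3 by (simp add: coeff_eq_0)
    ultimately show ?thesis ..
  qed (auto simp: e_def)
qed

text \<open>For each fixed t = c < 0 both sides have degree at most n - 1 and coefficient 1 at s^(n
  - 1). Hence agreement at n - 1 points, the common roots, suffices.\<close>

lemma real_poly2_lucas:
  assumes "n > 0"
  shows "real_poly2 (lucas n) = (\<Prod>k=1..n div 2. lucas_factor k n)" (is "_ = ?R")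
proof (rule poly_poly_eqI)
  show "infinite {..<0::real}"
    by (rule infinite_Iio)
next
  fix c :: real
  assume "c \<in> {..<0}"
  then obtain r where r: "r > 0" "c = - r\<^sup>2"
    by (intro that[of "sqrt (- c)"]) auto
  define g where "g k = poly (lucas_factor k n) [:c:]" for k
  have g: "degree (g k) = (if 2 * k = n then 1 else 2)" "lead_coeff (g k) = 1" for k
    by (auto simp: g_def lucas_factor_def)
  have R: "poly ?R [:c:] = (\<Prod>k=1..n div 2. g k)"
    by (simp add: poly_prod g_def)
  have g_nz: "g k \<noteq> 0" for k
    using g(2)[of k] by auto
  \<comment> \<open>Every factor has degree 2, except that for even n the last one, with 2 k = n,
    has degree 1.\<close>
  have degR: "degree (poly ?R [:c:]) = n - 1"
  proof -
    have "degree (poly ?R [:c:]) = (\<Sum>k=1..n div 2. if 2 * k = n then 1 else 2)"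
      unfolding R using g_nz by (subst degree_prod_eq_sum_degree) (auto simp: g)
    also have "\<dots> = n - 1"
    proof (cases "even n")
      case True
      then obtain m where m: "n = 2 * Suc m"
        using assms by (metis dvd_def gr0_implies_Suc mult_0_right neq0_conv)
      have "(\<Sum>k=1..m. if k = Suc m then 1 else 2 :: nat) = (\<Sum>k=1..m. 2)"
        by (intro sum.cong) auto
      then show ?thesis by (simp add: m)
    next
      case False
      then have "(\<Sum>k=1..n div 2. if 2 * k = n then 1 else 2) = (\<Sum>k=1..n div 2. 2 :: nat)"
        by (intro sum.cong) auto
      with False show ?thesis by (auto elim!: oddE)
    qed
    finally show ?thesis .
  qed
  have "lead_coeff (poly ?R [:c:]) = 1"
    unfolding R lead_coeff_prod by (simp only: g(2) prod.neutral_const)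
  then have coeffR: "coeff (poly ?R [:c:]) (n - 1) = 1"
    by (simp only: degR)
  define X where "X = (\<lambda>k. 2 * r * cos (pi * real k / real n)) ` {1..n - 1}"
  have "inj_on (\<lambda>k. 2 * r * cos (pi * real k / real n)) {1..n - 1}"
  proof (rule inj_onI)
    fix k l
    assume kl: "k \<in> {1..n - 1}" "l \<in> {1..n - 1}"
      and "2 * r * cos (pi * real k / real n) = 2 * r * cos (pi * real l / real n)"
    then have "cos (pi * real k / real n) = cos (pi * real l / real n)"
      using r by simp
    then have "pi * real k / real n = pi * real l / real n"
      using kl assms by (elim cos_inj_pi[rotated 4]) (auto simp: divide_simps)
    then show "k = l"
      using assms by simp
  qed
  then have cardX: "card X = n - 1"
    by (simp add: X_def card_image)
  show "poly (real_poly2 (lucas n)) [:c:] = poly ?R [:c:]"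
  proof (rule poly_eqI_degree_lead_coeff[of _ "n - 1" _ X])
    show "coeff (poly (real_poly2 (lucas n)) [:c:]) (n - 1) = coeff (poly ?R [:c:]) (n - 1)"
      "degree (poly (real_poly2 (lucas n)) [:c:]) \<le> n - 1"
      using degree_lucas_Suc[where c = c and n = "n - 1"] assms coeffR by auto
    show "card X \<ge> n - 1" "degree (poly ?R [:c:]) \<le> n - 1"
      using cardX degR by auto
    fix x
    assume "x \<in> X"
    then obtain k where k: "k \<in> {1..n - 1}" and x: "x = 2 * r * cos (pi * real k / real n)"
      by (auto simp: X_def)
    have "0 < pi * real k / real n" "pi * real k / real n < pi"
      using k assms by (auto simp: divide_simps)
    then have "sin (pi * real k / real n) > 0"
      by (rule sin_gt_zero)
    moreover have "sin (real n * (pi * real k / real n)) = 0"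
      using assms by (simp add: mult.commute)
    ultimately have L: "poly (poly (real_poly2 (lucas n)) [:c:]) x = 0"
      using lucas_sin[of r "pi * real k / real n" n] r by (simp add: x)
    \<comment> \<open>The cosines for k and n - k are opposite, so both indices give the same
      square; in the case 2 l = n the root is 0.\<close>
    have root: "poly (g l) x = 0" if l: "l = k \<or> l = n - k" for l
    proof -
      have "(cos (pi * real l / real n))\<^sup>2 = (cos (pi * real k / real n))\<^sup>2"
      proof (cases "l = k")
        case False
        with l k have "pi * real l / real n = pi - pi * real k / real n"
          using assms by (auto simp: field_simps of_nat_diff)
        then show ?thesis
          by (simp add: cos_diff)
      qed simp
      moreover have "cos (pi * real k / real n) = 0" if "2 * l = n"
      proof -
        have "n = 2 * k" "k > 0"
          using that l k by auto
        then show ?thesis by simp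
      qed
      ultimately show ?thesis
        by (auto simp: g_def lucas_factor_def x r(2) power2_eq_square algebra_simps)
    qed
    \<comment> \<open>The product runs over only half of the indices, but one of k and n - k always
      lies in that half.\<close>
    have "\<exists>l\<in>{1..n div 2}. l = k \<or> l = n - k"
    proof (cases "k \<le> n div 2")
      case True
      then show ?thesis using k by auto
    next
      case False
      then have "n - k \<in> {1..n div 2}"
        using k by auto
      then show ?thesis by blast
    qed
    then have "poly (poly ?R [:c:]) x = 0"
      unfolding R unfolding poly_prod using root by (intro prod_zero) auto
    with L show "poly (poly (real_poly2 (lucas n)) [:c:]) x = poly (poly ?R [:c:]) x"
      by simp
  qed
qed

section \<open>Atoms: grouping the factors by reduced fractions\<close>

text \<open>The analogue of a cyclotomic polynomial; the atom for d = 1 is the empty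
  product.\<close>

definition lucas_atom :: "nat \<Rightarrow> real poly poly" where
  "lucas_atom d = (\<Prod>k | k \<in> {1..d div 2} \<and> coprime k d. lucas_factor k d)"

lemma coeffs2_in_nonneg_lucas_atom: "coeffs2_in {0..} (lucas_atom d)"
  unfolding lucas_atom_def by (intro coeffs2_in_prod coeffs2_in_nonneg_lucas_factor) auto

text \<open>Reducing k / n to lowest terms is a bijection onto the reduced fractions in (0, 1/2]
  whose denominator divides n, and by \<open>lucas_factor_scale\<close> it preserves the
  factors.\<close>

lemma real_poly2_lucas_atoms:
  assumes "n > 0"
  shows "real_poly2 (lucas n) = (\<Prod>d | d dvd n. lucas_atom d)"
proof -
  have "(\<Prod>k=1..n div 2. lucas_factor k n) =
      (\<Prod>(d, k)\<in>(SIGMA d:{d. d dvd n}. {k. k \<in> {1..d div 2} \<and> coprime k d}). lucas_factor k d)"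
  proof (rule prod.reindex_bij_witness[where j = "\<lambda>k. (n div gcd k n, k div gcd k n)"
        and i = "\<lambda>(d, k). k * (n div d)"], goal_cases)
    case (1 k)
    have "n = (n div gcd k n) * gcd k n"
      by simp
    moreover have "n div gcd k n > 0"
      using assms by (simp add: div_greater_zero_iff)
    ultimately have "n div (n div gcd k n) = gcd k n"
      by (metis nonzero_mult_div_cancel_left less_not_refl)
    then show ?case
      by simp
  next
    case (2 k)
    define c where "c = gcd k n"
    have c: "c > 0" "c dvd k" "c dvd n"
      using assms by (auto simp: c_def)
    obtain a b where ab: "k = c * a" "n = c * b"
      using c by (auto simp: dvd_def)
    have "coprime a b"
      using div_gcd_coprime[of k n] assms c(1) unfolding c_def[symmetric] by (simp add: ab)
    moreover have "a \<ge> 1" "2 * a \<le> b"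
      using 2 c(1) by (auto simp: ab Suc_le_eq) (simp add: less_eq_div_iff_mult_less_eq mult.commute mult.left_commute)
    ultimately show ?case
      unfolding c_def[symmetric] using c(1) by (auto simp: ab)
  next
    case X: (3 x)
    obtain d k where x: "x = (d, k)"
      by (cases x)
    with X have k: "k \<in> {1..d div 2}" "coprime k d" and "d dvd n"
      by auto
    then obtain c where n: "n = d * c"
      by (auto simp: dvd_def)
    have "d > 0" "c > 0"
      using n assms by auto
    moreover have "gcd (k * c) (d * c) = c"
      using k(2) gcd_mult_distrib_nat[of c k d] by (simp add: mult.commute)
    ultimately show ?case
      by (simp add: x n)
  next
    case X: (4 x)
    obtain d k where x: "x = (d, k)"
      by (cases x)
    with X have k: "k \<in> {1..d div 2}" "coprime k d" and "d dvd n"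
      by auto
    then obtain c where n: "n = d * c"
      by (auto simp: dvd_def)
    have "d > 0" "c > 0" "2 * k \<le> d"
      using n k assms by auto
    moreover from this have "k * c \<le> d * c div 2"
      by (simp add: less_eq_div_iff_mult_less_eq)
    ultimately show ?case
      using k by (auto simp: x n)
  next
    case (5 k)
    define c where "c = gcd k n"
    have c: "c > 0" "c dvd k" "c dvd n"
      using assms by (auto simp: c_def)
    then have "lucas_factor (k div c) (n div c) = lucas_factor k n"
      using lucas_factor_scale[of c "k div c" "n div c"] by simp
    then show ?case
      by (simp add: c_def)
  qed
  also have "\<dots> = (\<Prod>d | d dvd n. lucas_atom d)"
    unfolding lucas_atom_def using assms by (subst prod.Sigma) auto
  finally show ?thesis
    using real_poly2_lucas[OF assms] by simp
qed

section \<open>Exponents of the atoms\<close>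

text \<open>The atom of d occurs once for each multiple of d up to N. The common bound M lets
  factorials of different arguments be combined index by index.\<close>

lemma real_poly2_lucas_fact_atoms:
  assumes "N \<le> M"
  shows "real_poly2 (lucas_fact N) = (\<Prod>d=1..M. lucas_atom d ^ (N div d))"
  using assms
proof (induction N)
  case (Suc N)
  have "real_poly2 (lucas (Suc N)) = (\<Prod>d | d dvd Suc N. lucas_atom d)"
    by (rule real_poly2_lucas_atoms) simp
  also have "\<dots> = (\<Prod>d=1..M. if d dvd Suc N then lucas_atom d else 1)"
  proof (rule prod.mono_neutral_cong_left)
    show "{d. d dvd Suc N} \<subseteq> {1..M}"
    proof
      fix d
      assume "d \<in> {d. d dvd Suc N}"
      then have "d \<le> Suc N" "d \<noteq> 0"
        by (auto dest: dvd_imp_le intro: Nat.gr0I)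
      with Suc.prems show "d \<in> {1..M}"
        by simp
    qed
  qed auto
  finally have "real_poly2 (lucas_fact (Suc N)) = (\<Prod>d=1..M. lucas_atom d ^ (N div d)) *
      (\<Prod>d=1..M. if d dvd Suc N then lucas_atom d else 1)"
    using Suc by (simp add: lucas_fact_def mult.commute del: lucas.simps)
  also have "\<dots> = (\<Prod>d=1..M. lucas_atom d ^ (Suc N div d))"
    unfolding prod.distrib[symmetric]
    by (intro prod.cong) (auto simp: div_Suc dvd_eq_mod_eq_0)
  finally show ?case .
qed (simp add: lucas_fact_def)

text \<open>The quotient parts cancel, leaving remainders a and b. There a + b is at most twice the
  larger one, whose quotient is one of the two terms on the right.\<close>

lemma super_catalan_exponent_nonneg:
  fixes m n d :: nat
  shows "m div d + n div d + (m + n) div d \<le> 2 * m div d + 2 * n div d"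
proof (cases "d = 0")
  case False
  have dm: "2 * x div d = 2 * (x div d) + (2 * (x mod d)) div d" for x
  proof -
    have "2 * x = 2 * (x mod d) + d * (2 * (x div d))"
      by (metis add.commute distrib_left mult.left_commute mult_div_mod_eq)
    with False show ?thesis by (simp add: div_mult_self2)
  qed
  have "(m + n) div d = m div d + n div d + (m mod d + n mod d) div d"
    by (rule div_add1_eq)
  moreover have "(m mod d + n mod d) div d \<le> (2 * (m mod d)) div d + (2 * (n mod d)) div d"
  proof -
    have "m mod d + n mod d \<le> 2 * max (m mod d) (n mod d)"
      by simp
    then have "(m mod d + n mod d) div d \<le> (2 * max (m mod d) (n mod d)) div d"
      by (rule div_le_mono)
    then show ?thesis
      by (auto simp: max_def split: if_splits)
  qed
  ultimately show ?thesis
    using dm[of m] dm[of n] by linarith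
qed simp

theorem theorem2:
  fixes m n :: nat
  shows "\<exists>p :: rat poly poly. super_fibo_catalan m n = to_fract p \<and> nonneg_int_coeffs p"
proof -
  define A where "A = lucas_fact (2 * m) * lucas_fact (2 * n)"
  define B where "B = lucas_fact m * lucas_fact n * lucas_fact (m + n)"
  \<comment> \<open>Any common bound for the five factorial arguments would do.\<close>
  define M where "M = 2 * m + 2 * n"
  define Q where "Q = (\<Prod>d=1..M. lucas_atom d ^
    (2 * m div d + 2 * n div d - (m div d + n div d + (m + n) div d)))"
  have "real_poly2 A = (\<Prod>d=1..M. lucas_atom d ^ (2 * m div d + 2 * n div d))"
    by (simp add: A_def M_def real_poly2_lucas_fact_atoms[of _ M, unfolded M_def]
        power_add prod.distrib)
  \<comment> \<open>The exponent inequality ensures that the natural subtraction in \<open>Q\<close>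
    does not truncate.\<close>
  also have "\<dots> = (\<Prod>d=1..M. lucas_atom d ^ (m div d + n div d + (m + n) div d)) * Q"
    unfolding Q_def prod.distrib[symmetric] power_add[symmetric]
    by (simp add: super_catalan_exponent_nonneg)
  also have "(\<Prod>d=1..M. lucas_atom d ^ (m div d + n div d + (m + n) div d)) = real_poly2 B"
    by (simp add: B_def M_def real_poly2_lucas_fact_atoms[of _ M, unfolded M_def]
        power_add prod.distrib)
  finally have "real_poly2 A = real_poly2 B * Q" .
  moreover have "coeffs2_in {0..} Q"
    unfolding Q_def
    by (intro coeffs2_in_prod coeffs2_in_power coeffs2_in_nonneg_lucas_atom) auto
  moreover have "coeffs2_in \<int> A" "coeffs2_in \<int> B"
    unfolding A_def B_def by (intro coeffs2_in_mult coeffs2_in_Ints_lucas_fact; simp)+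
  moreover have "\<exists>k. coeff B 0 = monom 1 k"
    using coeff_lucas_fact_0[of m] coeff_lucas_fact_0[of n] coeff_lucas_fact_0[of "m + n"]
    by (auto simp: B_def coeff_mult_0 mult_monom)
  ultimately obtain p where p: "A = B * p" "nonneg_int_coeffs p"
    using real_quotient_imp_nonneg_int_quotient by blast
  have "B \<noteq> 0"
    by (simp add: B_def lucas_fact_nonzero)
  then have "to_fract A / to_fract B = to_fract p"
    by (simp add: p(1))
  then show ?thesis
    using p(2) by (auto simp: super_fibo_catalan_def A_def B_def)
qed

end
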